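(* For every infinite cardinal $\kappa$ there is a hereditarily indecomposable continuum $K$ of weight $\kappa$, and $K$ admits an essential map onto the Tychonoff cube $[0,1]^\kappa$.
   Context: A continuum is a compact connected Hausdorff space. A compact Hausdorff space is hereditarily indecomposable if whenever two subcontinua of it meet, one of them is contained in the other. For disjoint closed sets $A,B$ in a space $Z$, a closed set $L$ is a partition between $A$ and $B$ if $Z\setminus L=U\cup V$ with $U,V$ disjoint open sets, $A\subseteq U$, $B\subseteq V$. A family $\{(A_i,B_i):i\in I\}$ of pairs of disjoint closed sets is essential if whenever $L_i$ is a partition between $A_i$ and $B_i$ for each $i\in I$, the intersection $\bigcap_{i\in I}L_i$ is nonempty. For $\alpha<\kappa$ let $A_\alpha=\{x\in[0,1]^\kappa:x_\alpha=0\}$ and $B_\alpha=\{x\in[0,1]^\kappa:x_\alpha=1\}$. A continuous map $f:K\to[0,1]^\kappa$ is essential if the family $\{(f^{-1}[A_\alpha],f^{-1}[B_\alpha]):\alpha<\kappa\}$ is essential in $K$. *)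

theory Defs
  imports "HOL-Analysis.Analysis" "HOL-Library.Equipollence"
begin

definition base_of :: "'a topology \<Rightarrow> 'a set set \<Rightarrow> bool" where
  "base_of X \<B> \<longleftrightarrow> (\<forall>B\<in>\<B>. openin X B) \<and>
     (\<forall>U. openin X U \<longrightarrow> (\<exists>\<C>. \<C> \<subseteq> \<B> \<and> \<Union>\<C> = U))"

definition has_weight :: "'a topology \<Rightarrow> 'k set \<Rightarrow> bool" where
  "has_weight X I \<longleftrightarrow> (\<exists>\<B>. base_of X \<B> \<and> \<B> \<approx> I) \<and>
     (\<forall>\<B>. base_of X \<B> \<longrightarrow> I \<lesssim> \<B>)"

definition continuum :: "'a topology \<Rightarrow> bool" where
  "continuum X \<longleftrightarrow> topspace X \<noteq> {} \<and> compact_space X \<and> connected_space X \<and> Hausdorff_space X"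

definition subcontinuum :: "'a topology \<Rightarrow> 'a set \<Rightarrow> bool" where
  "subcontinuum X C \<longleftrightarrow> C \<noteq> {} \<and> compactin X C \<and> connectedin X C"

definition hereditarily_indecomposable :: "'a topology \<Rightarrow> bool" where
  "hereditarily_indecomposable X \<longleftrightarrow> compact_space X \<and> Hausdorff_space X \<and>
     (\<forall>C D. subcontinuum X C \<and> subcontinuum X D \<and> C \<inter> D \<noteq> {} \<longrightarrow> C \<subseteq> D \<or> D \<subseteq> C)"

definition partition_between :: "'a topology \<Rightarrow> 'a set \<Rightarrow> 'a set \<Rightarrow> 'a set \<Rightarrow> bool" where
  "partition_between X A B L \<longleftrightarrow> closedin X L \<and>
     (\<exists>U V. openin X U \<and> openin X V \<and> disjnt U V \<and> topspace X - L = U \<union> V \<and>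
            A \<subseteq> U \<and> B \<subseteq> V)"

definition essential_family :: "'a topology \<Rightarrow> 'i set \<Rightarrow> ('i \<Rightarrow> 'a set) \<Rightarrow> ('i \<Rightarrow> 'a set) \<Rightarrow> bool" where
  "essential_family X I A B \<longleftrightarrow>
     (\<forall>i\<in>I. closedin X (A i) \<and> closedin X (B i) \<and> disjnt (A i) (B i)) \<and>
     (\<forall>L. (\<forall>i\<in>I. partition_between X (A i) (B i) (L i)) \<longrightarrow>
          (\<exists>x\<in>topspace X. \<forall>i\<in>I. x \<in> L i))"

text \<open>The Tychonoff cube [0,1]^\<kappa>, with \<kappa> = |UNIV :: 'k set|.\<close>
definition tychonoff_cube :: "('k \<Rightarrow> real) topology" where
  "tychonoff_cube = product_topology (\<lambda>_. top_of_set {0..1}) UNIV"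

definition essential_map :: "'a topology \<Rightarrow> ('a \<Rightarrow> 'k \<Rightarrow> real) \<Rightarrow> bool" where
  "essential_map K f \<longleftrightarrow> continuous_map K tychonoff_cube f \<and>
     essential_family K UNIV
       (\<lambda>\<alpha>. {x \<in> topspace K. f x \<alpha> = 0}) (\<lambda>\<alpha>. {x \<in> topspace K. f x \<alpha> = 1})"

end

theory Submission
  imports Defs
begin

text \<open>
  Let a coordinate \<open>j\<close> of the cube be reserved for a continuous function \<open>g\<close> with values in \<open>[-1/2, 1/2]\<close>, and
  let \<open>T\<close> be an S-shaped function on \<open>[-1, 1]\<close> from \<open>-1\<close> to \<open>1\<close>. The set of all \<open>z\<close> with
  \<open>T (2 z\<^sub>j - 1) = g z\<close> is a partition between the two faces of direction \<open>j\<close>, and it is crooked: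
  a connected subset on which \<open>g \<le> 0\<close> cannot pass the first turn of the S, and one on which \<open>g \<ge> 0\<close>
  cannot pass the second turn. If \<open>C\<close> and \<open>D\<close> are subcontinua, \<open>g \<le> 0\<close> on \<open>C\<close> with value \<open>-1/2\<close> at a
  point of \<open>C\<close>, and \<open>g \<ge> 0\<close> on \<open>D\<close> with value \<open>1/2\<close> at a point of \<open>D\<close>, then \<open>C\<close> lies before the first
  turn and \<open>D\<close> after the second, so they are disjoint. There are \<open>\<kappa>\<close> many functions \<open>g\<close> that
  detect all incomparable pairs of closed sets. Reserve a coordinate for each of them, leaving \<open>\<kappa>\<close>
  coordinates free. The intersection of these partitions is hereditarily indecomposable, and the free
  coordinates are essential on it because the family of all pairs of opposite faces of the cube is
  essential (Poincare-Miranda). A minimal closed subset on which they remain essential is connected.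
\<close>

subsection \<open>The Poincare-Miranda theorem for Tychonoff cubes\<close>

text \<open>Kuhn's combinatorial lemma is applied to the grid of mesh \<open>1 / Suc m\<close>,
  labelled by the signs of the \<open>\<phi> i\<close>: it yields a cell in which every label
  component takes both values. A subsequence of these cells shrinks to a point, where continuity
  forces every \<open>\<phi> i\<close> with \<open>i < n\<close> to vanish.\<close>

lemma poincare_miranda_finite:
  fixes \<phi> :: "nat \<Rightarrow> (nat \<Rightarrow> real) \<Rightarrow> real" and n :: nat
  defines "S \<equiv> {w. \<forall>i. w i \<in> {0..1::real}}"
  assumes cont: "\<And>i. i < n \<Longrightarrow> continuous_on S (\<phi> i)"
    and neg: "\<And>i w. \<lbrakk>i < n; w \<in> S; w i = 0\<rbrakk> \<Longrightarrow> \<phi> i w < 0"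
    and pos: "\<And>i w. \<lbrakk>i < n; w \<in> S; w i = 1\<rbrakk> \<Longrightarrow> \<phi> i w > 0"
  shows "\<exists>w\<in>S. \<forall>i<n. \<phi> i w = 0"
proof -
  \<comment> \<open>Capping at 1 puts \<open>pt m x\<close> into \<open>S\<close> for every
    \<open>x\<close>, so bounds on the corners of a cell do not have to be carried through the
    limit. Coordinates from \<open>n\<close> on are frozen at 0.\<close>
  define pt where "pt m x = (\<lambda>j. if j < n then min 1 (real (x j) / real (Suc m)) else 0)"
    for m and x :: "nat \<Rightarrow> nat"
  have ptS: "pt m x \<in> S" for m x
    by (auto simp: pt_def S_def)
  define label where "label m x i = (if \<phi> i (pt m x) > 0 then 1 else 0::nat)" for m x i
  have "\<exists>q. \<forall>i<n. \<exists>r s. (\<forall>j<n. q j \<le> r j \<and> r j \<le> q j + 1) \<and>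
          (\<forall>j<n. q j \<le> s j \<and> s j \<le> q j + 1) \<and> label m r i \<noteq> label m s i" for m
  proof -
    have L0: "\<forall>x. (\<forall>i<n. x i \<le> Suc m) \<longrightarrow> (\<forall>i<n. x i = 0 \<longrightarrow> label m x i = 0)"
    proof (intro allI impI)
      fix x :: "nat \<Rightarrow> nat" and i assume "i < n" "x i = 0"
      then have "pt m x i = 0" by (simp add: pt_def)
      then show "label m x i = 0" using neg[OF \<open>i < n\<close> ptS, of m x] by (simp add: label_def)
    qed
    have L1: "\<forall>x. (\<forall>i<n. x i \<le> Suc m) \<longrightarrow> (\<forall>i<n. x i = Suc m \<longrightarrow> label m x i = 1)"
    proof (intro allI impI)
      fix x :: "nat \<Rightarrow> nat" and i assume "i < n" "x i = Suc m"
      then have "pt m x i = 1" by (simp add: pt_def)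
      then show "label m x i = 1" using pos[OF \<open>i < n\<close> ptS, of m x] by (simp add: label_def)
    qed
    have L: "\<forall>x. (\<forall>i<n. x i \<le> Suc m) \<longrightarrow> (\<forall>i<n. label m x i = 0 \<or> label m x i = 1)"
      by (simp add: label_def)
    show ?thesis
      by (rule kuhn_lemma[OF zero_less_Suc L L0 L1], rule exI)
  qed
  then obtain q where q: "\<And>m i. i < n \<Longrightarrow> \<exists>r s. (\<forall>j<n. q m j \<le> r j \<and> r j \<le> q m j + 1) \<and>
          (\<forall>j<n. q m j \<le> s j \<and> s j \<le> q m j + 1) \<and> label m r i \<noteq> label m s i"
    by metis
  have S_eq: "S = PiE UNIV (\<lambda>_. {0..1})"
    by (auto simp: S_def)
  have "compactin (product_topology (\<lambda>_::nat. euclideanreal) UNIV) S"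
    unfolding S_eq by (simp add: compactin_PiE)
  then have "compact S"
    by (simp add: euclidean_product_topology)
  then have "seq_compact S"
    by (rule compact_imp_seq_compact)
  then obtain w \<rho> where w: "w \<in> S" and \<rho>: "strict_mono \<rho>"
    and lim: "((\<lambda>m. pt m (q m)) \<circ> \<rho>) \<longlonglongrightarrow> w"
    using ptS unfolding seq_compact_def by meson
  have coord: "(f \<longlonglongrightarrow> w) \<longleftrightarrow> (\<forall>j. (\<lambda>m. f m j) \<longlonglongrightarrow> w j)" for f :: "nat \<Rightarrow> nat \<Rightarrow> real"
    using limitin_componentwise[of "\<lambda>_. euclideanreal" UNIV f w sequentially]
    by (simp add: euclidean_product_topology)
  \<comment> \<open>The cells have side at most \<open>1 / Suc (\<rho> m)\<close>, so every choice
    of corners along the subsequence has the same limit \<open>w\<close>.\<close>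
  have close: "(\<lambda>m. pt (\<rho> m) (r m)) \<longlonglongrightarrow> w"
    if r: "\<And>m j. j < n \<Longrightarrow> q (\<rho> m) j \<le> r m j \<and> r m j \<le> q (\<rho> m) j + 1" for r
    unfolding coord
  proof
    fix j
    have c: "(\<lambda>m. pt (\<rho> m) (q (\<rho> m)) j) \<longlonglongrightarrow> w j"
      using lim by (simp add: coord o_def)
    have "\<bar>pt (\<rho> m) (r m) j - pt (\<rho> m) (q (\<rho> m)) j\<bar> \<le> 1 / real (Suc m)" for m
    proof (cases "j < n")
      case True
      have "m \<le> \<rho> m" using \<rho> by (rule seq_suble)
      then have "1 / real (Suc (\<rho> m)) \<le> 1 / real (Suc m)"
        by (intro divide_left_mono) auto
      moreover have "\<bar>real (r m j) / real (Suc (\<rho> m)) - real (q (\<rho> m) j) / real (Suc (\<rho> m))\<bar> \<le> 1 / real (Suc (\<rho> m))"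
        using r[OF True, of m]
        by (simp add: diff_divide_distrib[symmetric] divide_right_mono del: of_nat_Suc)
      moreover have "\<bar>min 1 a - min 1 b\<bar> \<le> \<bar>a - b\<bar>" for a b :: real
        by (auto simp: min_def)
      ultimately show ?thesis
        using True unfolding pt_def by (smt (verit, del_insts))
    qed (simp add: pt_def)
    then have "(\<lambda>m. pt (\<rho> m) (r m) j - pt (\<rho> m) (q (\<rho> m)) j) \<longlonglongrightarrow> 0"
      by (intro Lim_null_comparison[OF _ LIMSEQ_Suc[OF lim_1_over_n]]) auto
    from tendsto_add[OF this c] show "(\<lambda>m. pt (\<rho> m) (r m) j) \<longlonglongrightarrow> w j"
      by simp
  qed
  have "\<phi> i w = 0" if i: "i < n" for i
  proof -
    define near where "near m r \<longleftrightarrow> (\<forall>j<n. q m j \<le> r j \<and> r j \<le> q m j + 1)" for m r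
    \<comment> \<open>Which of the two differently labelled corners carries the positive sign may
      change with \<open>m\<close>; they are sorted into a nonpositive and a nonnegative sequence
      before passing to the limit.\<close>
    have "\<exists>r. near m r \<and> \<phi> i (pt m r) \<le> 0" "\<exists>r. near m r \<and> \<phi> i (pt m r) \<ge> 0" for m
      using q[OF i, of m] unfolding near_def[symmetric] label_def
      by (metis less_eq_real_def linorder_not_le)+
    then obtain a b where a: "\<And>m. near m (a m)" "\<And>m. \<phi> i (pt m (a m)) \<le> 0"
      and b: "\<And>m. near m (b m)" "\<And>m. \<phi> i (pt m (b m)) \<ge> 0"
      by metis
    have "(\<lambda>m. pt (\<rho> m) (a (\<rho> m))) \<longlonglongrightarrow> w"
      by (rule close) (use a near_def in blast)
    then have "(\<lambda>m. \<phi> i (pt (\<rho> m) (a (\<rho> m)))) \<longlonglongrightarrow> \<phi> i w"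
      by (rule continuous_on_tendsto_compose[OF cont[OF i] _ w]) (simp add: ptS)
    then have "\<phi> i w \<le> 0"
      by (rule LIMSEQ_le_const2) (use a in auto)
    have "(\<lambda>m. pt (\<rho> m) (b (\<rho> m))) \<longlonglongrightarrow> w"
      by (rule close) (use b near_def in blast)
    then have "(\<lambda>m. \<phi> i (pt (\<rho> m) (b (\<rho> m)))) \<longlonglongrightarrow> \<phi> i w"
      by (rule continuous_on_tendsto_compose[OF cont[OF i] _ w]) (simp add: ptS)
    then have "\<phi> i w \<ge> 0"
      by (rule LIMSEQ_le_const) (use b in auto)
    with \<open>\<phi> i w \<le> 0\<close> show ?thesis by simp
  qed
  with w show ?thesis by blast
qed

lemma topspace_tychonoff_cube: "topspace tychonoff_cube = {z. \<forall>\<alpha>. z \<alpha> \<in> {0..1}}"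
  by (auto simp: tychonoff_cube_def)

lemma compact_tychonoff_cube: "compact_space tychonoff_cube"
  by (simp add: tychonoff_cube_def compact_space_product_topology compact_space_subtopology)

lemma Hausdorff_tychonoff_cube: "Hausdorff_space tychonoff_cube"
  by (simp add: tychonoff_cube_def Hausdorff_space_product_topology Hausdorff_space_subtopology)

text \<open>Compactness reduces the claim to finitely many equations. These are solved on a
  finite-dimensional face of the cube, where the finite theorem applies.\<close>

lemma poincare_miranda_tychonoff:
  fixes \<phi> :: "'k \<Rightarrow> ('k \<Rightarrow> real) \<Rightarrow> real"
  assumes cont: "\<And>\<alpha>. continuous_map tychonoff_cube euclideanreal (\<phi> \<alpha>)"
    and neg: "\<And>\<alpha> z. \<lbrakk>z \<in> topspace tychonoff_cube; z \<alpha> = 0\<rbrakk> \<Longrightarrow> \<phi> \<alpha> z < 0"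
    and pos: "\<And>\<alpha> z. \<lbrakk>z \<in> topspace tychonoff_cube; z \<alpha> = 1\<rbrakk> \<Longrightarrow> \<phi> \<alpha> z > 0"
  shows "\<exists>z\<in>topspace tychonoff_cube. \<forall>\<alpha>. \<phi> \<alpha> z = 0"
proof -
  define Z where "Z \<alpha> = {z \<in> topspace tychonoff_cube. \<phi> \<alpha> z \<in> {0}}" for \<alpha>
  have Zc: "closedin tychonoff_cube (Z \<alpha>)" for \<alpha>
    unfolding Z_def by (rule closedin_continuous_map_preimage[OF cont]) simp
  have fin: "topspace tychonoff_cube \<inter> (\<Inter>\<alpha>\<in>F. Z \<alpha>) \<noteq> {}" if F: "finite F" for F
  proof -
    obtain e where e: "bij_betw e {..<card F} F"
      using ex_bij_betw_nat_finite[OF F] by (auto simp: atLeast0LessThan)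
    define g where "g = the_inv_into {..<card F} e"
    \<comment> \<open>This embeds the finite-dimensional cube as the face on which all coordinates
      outside \<open>F\<close> are 0; \<open>g\<close> inverts the enumeration \<open>e\<close> of
      \<open>F\<close>.\<close>
    define c where "c w = (\<lambda>\<alpha>. if \<alpha> \<in> F then w (g \<alpha>) else (0::real))" for w :: "nat \<Rightarrow> real"
    define S where "S = {w. \<forall>i::nat. w i \<in> {0..1::real}}"
    have cw: "c w (e i) = w i" if "i < card F" for w i
      using e that by (auto simp: c_def g_def bij_betw_def the_inv_into_f_f)
    have cS: "c w \<in> topspace tychonoff_cube" if "w \<in> S" for w
      using that by (auto simp: c_def S_def topspace_tychonoff_cube)
    have "continuous_map (top_of_set S) tychonoff_cube c"
      unfolding tychonoff_cube_def continuous_map_componentwise_UNIV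
    proof
      fix \<alpha>
      have "continuous_on S (\<lambda>w. w (g \<alpha>))"
        by (rule continuous_on_product_then_coordinatewise[OF continuous_on_id])
      then show "continuous_map (top_of_set S) (top_of_set {0..1}) (\<lambda>w. c w \<alpha>)"
        by (auto simp: c_def S_def)
    qed
    then have cont': "continuous_on S (\<lambda>w. \<phi> (e i) (c w))" for i
      using continuous_map_compose[OF _ cont[of "e i"]] by (fastforce simp: o_def)
    have "\<exists>w\<in>S. \<forall>i<card F. \<phi> (e i) (c w) = 0"
      by (rule poincare_miranda_finite[where \<phi> = "\<lambda>i w. \<phi> (e i) (c w)", folded S_def])
        (use cont' cS cw neg pos in auto)
    then obtain w where w: "w \<in> S" "\<And>i. i < card F \<Longrightarrow> \<phi> (e i) (c w) = 0"
      by blast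
    then have "\<phi> \<alpha> (c w) = 0" if "\<alpha> \<in> F" for \<alpha>
      using e that by (force simp: bij_betw_def)
    then show ?thesis
      using cS[OF w(1)] by (auto simp: Z_def)
  qed
  have fip: "\<forall>\<F>. finite \<F> \<and> \<F> \<subseteq> range Z \<longrightarrow> topspace tychonoff_cube \<inter> \<Inter>\<F> \<noteq> {}"
    using fin by (metis (no_types, lifting) finite_subset_image)
  have "topspace tychonoff_cube \<inter> \<Inter>(range Z) \<noteq> {}"
    by (rule mp[OF spec[OF conjunct2[OF compact_tychonoff_cube[unfolded compact_space_def compactin_fip]]]])
      (use Zc fip in \<open>simp only: ball_simps, blast\<close>)
  then show ?thesis
    by (auto simp: Z_def)
qed

subsection \<open>Minimal essential sets\<close>

text \<open>Essentiality of the traces of \<open>A\<close> and \<open>B\<close> on \<open>M\<close>, with partitions replaced by zero sets of functions on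
  the whole space. In this form it passes to intersections of chains by compactness alone, and
  failures on two disjoint closed sets can be glued.\<close>

definition essential_on :: "'a topology \<Rightarrow> ('i \<Rightarrow> 'a set) \<Rightarrow> ('i \<Rightarrow> 'a set) \<Rightarrow> 'a set \<Rightarrow> bool" where
  "essential_on X A B M \<longleftrightarrow> closedin X M \<and>
     (\<forall>\<phi>. (\<forall>i. continuous_map X euclideanreal (\<phi> i) \<and> (\<forall>x\<in>A i. \<phi> i x < 0) \<and> (\<forall>x\<in>B i. \<phi> i x > 0))
        \<longrightarrow> (\<exists>x\<in>M. \<forall>i. \<phi> i x = 0))"

lemma essential_onD:
  assumes "essential_on X A B M" "\<And>i. continuous_map X euclideanreal (\<phi> i)"
    "\<And>i x. x \<in> A i \<Longrightarrow> \<phi> i x < 0" "\<And>i x. x \<in> B i \<Longrightarrow> \<phi> i x > 0"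
  shows "\<exists>x\<in>M. \<forall>i. \<phi> i x = 0"
  using assms unfolding essential_on_def by blast

lemma not_essential_onE:
  assumes "\<not> essential_on X A B M" "closedin X M"
  obtains \<phi> where "\<And>i. continuous_map X euclideanreal (\<phi> i)"
    "\<And>i x. x \<in> A i \<Longrightarrow> \<phi> i x < 0" "\<And>i x. x \<in> B i \<Longrightarrow> \<phi> i x > 0"
    "\<And>x. x \<in> M \<Longrightarrow> \<exists>i. \<phi> i x \<noteq> 0"
  using assms unfolding essential_on_def by blast

text \<open>Zorn's lemma, using compactness for chains: if \<open>\<phi>\<close> had no common zero
  left in the intersection of a chain, its compact common zero set would be covered by the
  complements, hence by a single one of them, and one member of the chain would already fail to be
  essential.\<close>

lemma exists_minimal_essential_on:
  assumes X: "compact_space X" and N: "essential_on X A B N"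
  obtains M where "M \<subseteq> N" "essential_on X A B M"
    "\<And>M'. \<lbrakk>M' \<subseteq> M; essential_on X A B M'\<rbrakk> \<Longrightarrow> M' = M"
proof -
  \<comment> \<open>Passing to complements turns minimal closed sets into maximal open ones, so that
    chains have their unions as upper bounds.\<close>
  define \<A> where "\<A> = {U. openin X U \<and> topspace X - N \<subseteq> U \<and> essential_on X A B (topspace X - U)}"
  have NX: "N \<subseteq> topspace X"
    using N by (simp add: essential_on_def closedin_subset)
  have "\<exists>M\<in>\<A>. \<forall>X\<in>\<A>. M \<subseteq> X \<longrightarrow> X = M"
  proof (rule subset_Zorn_nonempty)
    have "topspace X - N \<in> \<A>"
      using N NX by (auto simp: \<A>_def essential_on_def double_diff)
    then show "\<A> \<noteq> {}" by blast
    fix \<C> assume ne: "\<C> \<noteq> {}" and ch: "subset.chain \<A> \<C>"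
    then have sub: "\<C> \<subseteq> \<A>" by (simp add: subset_chain_def)
    have "openin X (\<Union>\<C>)"
      using sub by (auto simp: \<A>_def)
    moreover have "topspace X - N \<subseteq> \<Union>\<C>"
      using sub ne by (auto simp: \<A>_def)
    moreover have "essential_on X A B (topspace X - \<Union>\<C>)"
      unfolding essential_on_def
    proof (intro conjI allI impI)
      show "closedin X (topspace X - \<Union>\<C>)"
        using \<open>openin X (\<Union>\<C>)\<close> by blast
      fix \<phi> assume \<phi>: "\<forall>i. continuous_map X euclideanreal (\<phi> i) \<and> (\<forall>x\<in>A i. \<phi> i x < 0) \<and> (\<forall>x\<in>B i. \<phi> i x > 0)"
      define Z where "Z = (\<Inter>i. {x \<in> topspace X. \<phi> i x \<in> {0}})"
      have "closedin X Z"
        unfolding Z_def using \<phi> closedin_continuous_map_preimage[of X euclideanreal _ "{0}"]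
        by (intro closedin_Inter) auto
      then have Zc: "compactin X Z"
        using X closedin_compact_space by blast
      show "\<exists>x\<in>topspace X - \<Union>\<C>. \<forall>i. \<phi> i x = 0"
      proof (rule ccontr)
        assume "\<not> ?thesis"
        then have "Z \<subseteq> \<Union>\<C>"
          by (auto simp: Z_def)
        then obtain \<F> where \<F>: "finite \<F>" "\<F> \<subseteq> \<C>" "Z \<subseteq> \<Union>\<F>"
          using compactinD[OF Zc _ \<open>Z \<subseteq> \<Union>\<C>\<close>] sub unfolding \<A>_def by blast
        have "\<exists>U\<in>\<C>. Z \<subseteq> U"
        proof (cases "\<F> = {}")
          case True
          then show ?thesis using \<F> ne by auto
        next
          case False
          have "subset.chain \<A> \<F>"
            unfolding subset_chain_def
          proof (intro conjI ballI)
            show "\<F> \<subseteq> \<A>"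
              using \<F>(2) sub by (rule subset_trans)
            show "S \<subseteq> T \<or> T \<subseteq> S" if "S \<in> \<F>" "T \<in> \<F>" for S T
              using ch that[THEN subsetD[OF \<F>(2)]] unfolding subset_chain_def by simp
          qed
          then have "\<Union>\<F> \<in> \<F>"
            by (rule Union_in_chain[OF \<F>(1) False])
          then show ?thesis using \<F> by blast
        qed
        then obtain U where "U \<in> \<C>" "Z \<subseteq> U" by blast
        then have "essential_on X A B (topspace X - U)"
          using sub by (auto simp: \<A>_def)
        then obtain x where "x \<in> topspace X - U" "\<forall>i. \<phi> i x = 0"
          using essential_onD[of X A B "topspace X - U" \<phi>] \<phi> by blast
        then show False
          using \<open>Z \<subseteq> U\<close> by (auto simp: Z_def)
      qed
    qed
    ultimately show "\<Union>\<C> \<in> \<A>"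
      by (simp add: \<A>_def)
  qed
  then obtain U where U: "U \<in> \<A>" "\<And>V. \<lbrakk>V \<in> \<A>; U \<subseteq> V\<rbrakk> \<Longrightarrow> V = U"
    by blast
  show ?thesis
  proof
    show "topspace X - U \<subseteq> N" "essential_on X A B (topspace X - U)"
      using U by (auto simp: \<A>_def)
    fix M' assume M': "M' \<subseteq> topspace X - U" "essential_on X A B M'"
    then have "closedin X M'" "topspace X - (topspace X - M') = M'"
      by (auto simp: essential_on_def)
    then have "topspace X - M' \<in> \<A>"
      using M' U(1) by (auto simp: \<A>_def)
    moreover have "U \<subseteq> topspace X - M'"
      using U(1) M'(1) openin_subset[of X U] by (auto simp: \<A>_def)
    ultimately have "topspace X - M' = U"
      by (rule U(2))
    moreover have "M' \<subseteq> topspace X"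
      using M'(1) by blast
    ultimately show "M' = topspace X - U"
      by blast
  qed
qed

text \<open>If \<open>M\<close> splits into two closed pieces, minimality gives for each piece a
  system of functions without common zero on it. A Urysohn function blends the two systems; convex
  combinations preserve the signs on \<open>A\<close> and \<open>B\<close>, so the blend contradicts
  essentiality of \<open>M\<close>.\<close>

lemma minimal_essential_on_connected:
  assumes X: "normal_space X" and M: "essential_on X A B M"
    and min: "\<And>M'. \<lbrakk>M' \<subseteq> M; essential_on X A B M'\<rbrakk> \<Longrightarrow> M' = M"
  shows "connectedin X M"
proof (rule ccontr)
  have MX: "closedin X M"
    using M by (simp add: essential_on_def)
  assume "\<not> connectedin X M"
  then obtain P Q where PQ: "closedin X P" "closedin X Q" "M \<subseteq> P \<union> Q" "P \<inter> Q \<inter> M = {}"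
    "P \<inter> M \<noteq> {}" "Q \<inter> M \<noteq> {}"
    using closedin_subset[OF MX] unfolding connectedin_closedin by blast
  then have c: "closedin X (P \<inter> M)" "closedin X (Q \<inter> M)"
    using MX by auto
  have "\<not> essential_on X A B (P \<inter> M)" "\<not> essential_on X A B (Q \<inter> M)"
    using min[of "P \<inter> M"] min[of "Q \<inter> M"] PQ by auto
  note P = this(1) and Q = this(2)
  obtain p where p: "\<And>i. continuous_map X euclideanreal (p i)" "\<And>i x. x \<in> A i \<Longrightarrow> p i x < 0"
      "\<And>i x. x \<in> B i \<Longrightarrow> p i x > 0" "\<And>x. x \<in> P \<inter> M \<Longrightarrow> \<exists>i. p i x \<noteq> 0"
    by (rule not_essential_onE[OF P c(1)]) (rule that, assumption+)
  obtain q where q: "\<And>i. continuous_map X euclideanreal (q i)" "\<And>i x. x \<in> A i \<Longrightarrow> q i x < 0"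
      "\<And>i x. x \<in> B i \<Longrightarrow> q i x > 0" "\<And>x. x \<in> Q \<inter> M \<Longrightarrow> \<exists>i. q i x \<noteq> 0"
    by (rule not_essential_onE[OF Q c(2)]) (rule that, assumption+)
  obtain h where h: "continuous_map X (top_of_set {0..1::real}) h" "h ` (P \<inter> M) \<subseteq> {0}" "h ` (Q \<inter> M) \<subseteq> {1}"
    using Urysohn_lemma[OF X c, of 0 1] PQ(4) by (auto simp: disjnt_def)
  then have hc: "continuous_map X euclideanreal h" and h01: "\<And>x. x \<in> topspace X \<Longrightarrow> 0 \<le> h x \<and> h x \<le> 1"
    by (auto simp: continuous_map_in_subtopology image_subset_iff Pi_iff)
  \<comment> \<open>Outside \<open>topspace X\<close> the values of \<open>h\<close> are
    unconstrained and convexity could fail, so there the blend is replaced by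
    \<open>p\<close>.\<close>
  define \<phi> where "\<phi> i x = (if x \<in> topspace X then (1 - h x) * p i x + h x * q i x else p i x)" for i x
  have "\<exists>x\<in>M. \<forall>i. \<phi> i x = 0"
  proof (rule essential_onD[OF M])
    fix i
    have "continuous_map X euclideanreal (\<lambda>x. (1 - h x) * p i x + h x * q i x)"
      by (intro continuous_intros hc p q)
    then show "continuous_map X euclideanreal (\<phi> i)"
      by (rule continuous_map_eq) (simp add: \<phi>_def)
    fix x
    have conv: "(1 - t) * a + t * b < 0" if "a < 0" "b < 0" "0 \<le> t" "t \<le> 1" for a b t :: real
      using that convex_bound_lt[of a 0 b "1 - t" t] by simp
    have conv': "(1 - t) * a + t * b > 0" if "a > 0" "b > 0" "0 \<le> t" "t \<le> 1" for a b t :: real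
      using conv[of "- a" "- b" t] that by (simp add: algebra_simps)
    show "\<phi> i x < 0" if "x \<in> A i"
      using conv[of "p i x" "q i x" "h x"] h01[of x] p(2)[OF that] q(2)[OF that] by (simp add: \<phi>_def)
    show "\<phi> i x > 0" if "x \<in> B i"
      using conv'[of "p i x" "q i x" "h x"] h01[of x] p(3)[OF that] q(3)[OF that] by (simp add: \<phi>_def)
  qed
  then obtain x where x: "x \<in> M" "\<And>i. \<phi> i x = 0" by blast
  have xX: "x \<in> topspace X" using x closedin_subset[OF MX] by blast
  consider "x \<in> P \<inter> M" | "x \<in> Q \<inter> M" using x PQ(3) by blast
  then show False
  proof cases
    case 1
    then have "h x = 0" using h by blast
    then show False using x(2) p(4)[OF 1] xX by (simp add: \<phi>_def)
  next
    case 2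
    then have "h x = 1" using h by blast
    then show False using x(2) q(4)[OF 2] xX by (simp add: \<phi>_def)
  qed
qed

text \<open>The way back from functions to partitions: partitions of \<open>M\<close> with empty
  intersection would produce functions on \<open>X\<close> without common zero on \<open>M\<close>.
  The sets \<open>A'\<close> and \<open>B'\<close> may exceed the traces of \<open>A\<close> and
  \<open>B\<close>, which makes room for a map that is constant near the faces.\<close>

lemma essential_on_imp_essential_family:
  assumes X: "compact_space X" "Hausdorff_space X" and M: "essential_on X A B M"
    and AB: "\<And>i. closedin X (A i)" "\<And>i. closedin X (B i)" "\<And>i. disjnt (A i) (B i)"
    and AB': "\<And>i. closedin (subtopology X M) (A' i)" "\<And>i. closedin (subtopology X M) (B' i)"
      "\<And>i. disjnt (A' i) (B' i)" "\<And>i. A i \<inter> M \<subseteq> A' i" "\<And>i. B i \<inter> M \<subseteq> B' i"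
  shows "essential_family (subtopology X M) UNIV A' B'"
  unfolding essential_family_def
proof (intro conjI allI impI)
  show "\<forall>i\<in>UNIV. closedin (subtopology X M) (A' i) \<and> closedin (subtopology X M) (B' i) \<and> disjnt (A' i) (B' i)"
    using AB' by blast
  have MX: "closedin X M"
    using M by (simp add: essential_on_def)
  define Y where "Y = subtopology X M"
  have Y: "compact_space Y" "Hausdorff_space Y"
    using X MX by (auto simp: Y_def compact_space_subtopology closedin_compact_space Hausdorff_space_subtopology)
  have normal: "normal_space X"
    using X by (simp add: compact_Hausdorff_or_regular_imp_normal_space)
  from Y have reg: "regular_space Y"
    by (simp add: compact_Hausdorff_imp_regular_space)
  have tY: "topspace Y = M"
    using closedin_subset[OF MX] by (auto simp: Y_def)
  have Yc: "closedin X C" if "closedin Y C" for C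
    using that MX closedin_closed_subtopology unfolding Y_def by blast
  fix L assume "\<forall>i\<in>UNIV. partition_between (subtopology X M) (A' i) (B' i) (L i)"
  then have "\<forall>i. closedin Y (L i) \<and> (\<exists>U V. openin Y U \<and> openin Y V \<and> disjnt U V \<and>
      M - L i = U \<union> V \<and> A' i \<subseteq> U \<and> B' i \<subseteq> V)"
    unfolding partition_between_def Y_def[symmetric] tY by blast
  then obtain U V where L: "\<And>i. closedin Y (L i)" and
    "\<forall>i. openin Y (U i) \<and> openin Y (V i) \<and> disjnt (U i) (V i) \<and>
      M - L i = U i \<union> V i \<and> A' i \<subseteq> U i \<and> B' i \<subseteq> V i"
    by metis
  then have U: "\<And>i. openin Y (U i)" and V: "\<And>i. openin Y (V i)"
    and UV: "\<And>i. disjnt (U i) (V i)" "\<And>i. M - L i = U i \<union> V i"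
    and AU: "\<And>i. A' i \<subseteq> U i" and BV: "\<And>i. B' i \<subseteq> V i"
    by blast+
  show "\<exists>x\<in>topspace (subtopology X M). \<forall>i\<in>UNIV. x \<in> L i"
  proof (rule ccontr)
    assume "\<not> ?thesis"
    then have "\<forall>x\<in>M. \<exists>i. x \<notin> L i"
      using tY Y_def by auto
    then obtain k where k: "\<And>x. x \<in> M \<Longrightarrow> x \<notin> L (k x)"
      by metis
    \<comment> \<open>Regularity separates each point from a partition that misses it. A finite
      subcover will make every \<open>E i\<close> a finite union of closed sets.\<close>
    have "\<forall>x\<in>M. \<exists>W W'. openin Y W \<and> openin Y W' \<and> x \<in> W \<and> L (k x) \<subseteq> W' \<and> disjnt W W'"
      using reg k L unfolding regular_space_def tY by blast
    then obtain W W' where "\<forall>x\<in>M. openin Y (W x) \<and> openin Y (W' x) \<and> x \<in> W x \<and> L (k x) \<subseteq> W' x \<and> disjnt (W x) (W' x)"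
      by metis
    then have W: "\<And>x. x \<in> M \<Longrightarrow> openin Y (W x)" "\<And>x. x \<in> M \<Longrightarrow> openin Y (W' x)"
        "\<And>x. x \<in> M \<Longrightarrow> x \<in> W x" "\<And>x. x \<in> M \<Longrightarrow> L (k x) \<subseteq> W' x" "\<And>x. x \<in> M \<Longrightarrow> disjnt (W x) (W' x)"
      by blast+
    have "compactin Y M"
      using Y tY by (simp add: compact_space_def)
    moreover have "M \<subseteq> \<Union>(W ` M)"
      using W by blast
    ultimately obtain \<F> where "finite \<F>" "\<F> \<subseteq> W ` M" "M \<subseteq> \<Union>\<F>"
      using compactinD[of Y M "W ` M"] W(1) by blast
    then obtain T where T: "finite T" "T \<subseteq> M" "M \<subseteq> \<Union>(W ` T)"
      using finite_subset_image[of \<F> W M] by blast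
    \<comment> \<open>\<open>L i\<close> need not be a zero set, but the sets \<open>E i\<close> avoid \<open>L i\<close> and still cover \<open>M\<close>.\<close>
    define E where "E i = (\<Union>x\<in>{x\<in>T. k x = i}. M - W' x)" for i
    have Ec: "closedin Y (E i)" for i
      unfolding E_def
    proof (rule closedin_Union)
      fix S assume "S \<in> (\<lambda>x. M - W' x) ` {x \<in> T. k x = i}"
      then show "closedin Y S"
        using W(2) T(2) tY by (auto intro!: closedin_diff)
    qed (use T in auto)
    have EL: "E i \<inter> L i = {}" for i
      using W(4) T(2) by (auto simp: E_def)
    have cover: "\<exists>i. x \<in> E i" if "x \<in> M" for x
      using that T W(5) by (fastforce simp: E_def disjnt_iff)
    have EM: "E i \<subseteq> M" for i
      by (auto simp: E_def)
    \<comment> \<open>As \<open>E i\<close> misses \<open>L i\<close>, it lies in the disjoint union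
      of \<open>U i\<close> and \<open>V i\<close>. Hence \<open>E i - V i\<close> is its part in
      \<open>U i\<close>, written so that it is visibly closed.\<close>
    have "\<exists>f. continuous_map X euclideanreal f \<and> f ` (A i \<union> (E i - V i)) \<subseteq> {-1} \<and> f ` (B i \<union> (E i - U i)) \<subseteq> {1}" for i
    proof -
      have "closedin X (A i \<union> (E i - V i))" "closedin X (B i \<union> (E i - U i))"
        using AB Ec U V Yc by (simp_all add: closedin_Un closedin_diff)
      moreover have "disjnt (A i \<union> (E i - V i)) (B i \<union> (E i - U i))"
        using AB(3)[of i] AB'(4,5)[of i] AU[of i] BV[of i] UV(1)[of i] UV(2)[of i] EL[of i] EM[of i]
        unfolding disjnt_def by blast
      ultimately show ?thesis
        using normal_space_iff_Urysohn_gen_alt[of "-1" "1::real" X] normal by simp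
    qed
    then obtain \<phi> where \<phi>: "\<And>i. continuous_map X euclideanreal (\<phi> i)"
      "\<And>i. \<phi> i ` (A i \<union> (E i - V i)) \<subseteq> {-1}" "\<And>i. \<phi> i ` (B i \<union> (E i - U i)) \<subseteq> {1}"
      by metis
    have "\<exists>x\<in>M. \<forall>i. \<phi> i x = 0"
    proof (rule essential_onD[OF M \<phi>(1)])
      fix i x
      show "\<phi> i x < 0" if "x \<in> A i"
      proof -
        have "\<phi> i x = -1" using \<phi>(2)[of i] that by blast
        then show ?thesis by simp
      qed
      show "\<phi> i x > 0" if "x \<in> B i"
      proof -
        have "\<phi> i x = 1" using \<phi>(3)[of i] that by blast
        then show ?thesis by simp
      qed
    qed
    then obtain x where x: "x \<in> M" "\<And>i. \<phi> i x = 0" by blast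
    obtain i where i: "x \<in> E i" using cover x by blast
    then have "x \<in> E i - V i \<or> x \<in> E i - U i"
      using UV(1)[of i] by (auto simp: disjnt_iff)
    then have "\<phi> i x = -1 \<or> \<phi> i x = 1"
      using \<phi>(2,3)[of i] by blast
    then show False using x(2)[of i] by simp
  qed
qed

subsection \<open>Cardinality and transport\<close>

lemma infinite_times_lepoll_self:
  assumes "infinite A"
  shows "A \<times> A \<lesssim> A"
  using card_of_Times_same_infinite[OF assms] eqpoll_iff_card_of_ordIso eqpoll_imp_lepoll by blast

lemma infinite_lists_lepoll_self:
  assumes "infinite A"
  shows "lists A \<lesssim> A"
proof -
  obtain p where p: "inj_on p (A \<times> A)" "p ` (A \<times> A) \<subseteq> A"
    using infinite_times_lepoll_self[OF assms] unfolding lepoll_def by (elim exE conjE) (rule that)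
  have pA: "p (x, y) \<in> A" if "x \<in> A" "y \<in> A" for x y
    by (intro subsetD[OF p(2)] imageI SigmaI that)
  obtain \<iota> :: "nat \<Rightarrow> 'a" where \<iota>: "inj \<iota>" "range \<iota> \<subseteq> A"
    using assms unfolding infinite_le_lepoll lepoll_def by (elim exE conjE) (rule that)
  \<comment> \<open>Iterated pairing is injective only among lists of equal length, since
    \<open>\<iota> 0\<close> may itself be a pair code; therefore the length is recorded as
    well.\<close>
  define enc where "enc xs = foldr (\<lambda>x y. p (x, y)) xs (\<iota> 0)" for xs
  have encA: "enc xs \<in> A" if "xs \<in> lists A" for xs
    using that
  proof (induction xs)
    case Nil
    then show ?case using \<iota>(2) by (auto simp: enc_def)
  next
    case (Cons x xs)
    then show ?case using pA by (simp add: enc_def)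
  qed
  have encI: "xs = ys" if "length xs = length ys" "xs \<in> lists A" "ys \<in> lists A" "enc xs = enc ys" for xs ys
    using that
  proof (induction rule: list_induct2)
    case (Cons x xs y ys)
    then have "p (x, enc xs) = p (y, enc ys)" by (simp add: enc_def)
    then have "(x, enc xs) = (y, enc ys)"
      using Cons.prems encA by (intro inj_onD[OF p(1)]) auto
    then show ?case using Cons by simp
  qed simp
  have "inj_on (\<lambda>xs. p (\<iota> (length xs), enc xs)) (lists A)"
  proof (rule inj_onI)
    fix xs ys assume *: "xs \<in> lists A" "ys \<in> lists A" "p (\<iota> (length xs), enc xs) = p (\<iota> (length ys), enc ys)"
    then have "(\<iota> (length xs), enc xs) = (\<iota> (length ys), enc ys)"
      using encA \<iota>(2) by (intro inj_onD[OF p(1)]) auto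
    then show "xs = ys"
      using * encI \<iota>(1) by (auto dest: injD)
  qed
  moreover have "(\<lambda>xs. p (\<iota> (length xs), enc xs)) ` lists A \<subseteq> A"
  proof (rule image_subsetI)
    show "p (\<iota> (length xs), enc xs) \<in> A" if "xs \<in> lists A" for xs
      using pA[OF _ encA[OF that]] \<iota>(2) by blast
  qed
  ultimately show ?thesis
    unfolding lepoll_def by blast
qed

lemma infinite_Fpow_lepoll_self:
  assumes "infinite A"
  shows "Fpow A \<lesssim> A"
proof -
  have "Fpow A \<subseteq> set ` lists A"
    by (auto simp: Fpow_def lists_eq_set image_iff) (metis finite_list)
  then have "Fpow A \<lesssim> lists A"
    by (rule subset_image_lepoll)
  then show ?thesis
    using infinite_lists_lepoll_self[OF assms] lepoll_trans by blast
qed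

text \<open>Counts the codes of \<open>bump\<close> functions. This bounds both the size of a base
  and the number of coordinates to be reserved.\<close>

lemma infinite_int_triples_lists_lepoll:
  assumes "infinite (UNIV :: 'k set)"
  shows "(UNIV :: ('k \<times> int \<times> int) list set) \<lesssim> (UNIV :: 'k set)"
proof -
  have "(UNIV :: int set) \<lesssim> (UNIV :: nat set)"
    unfolding lepoll_def by (intro exI[of _ to_nat]) simp
  then have i: "(UNIV :: int set) \<lesssim> (UNIV :: 'k set)"
    using assms infinite_le_lepoll lepoll_trans by blast
  have "(UNIV :: 'k set) \<times> (UNIV :: int set) \<times> (UNIV :: int set) \<lesssim> (UNIV :: 'k set) \<times> (UNIV :: 'k set) \<times> (UNIV :: 'k set)"
    by (intro times_lepoll_mono i lepoll_refl)
  also have "\<dots> \<lesssim> (UNIV :: 'k set) \<times> (UNIV :: 'k set)"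
    by (intro times_lepoll_mono infinite_times_lepoll_self assms lepoll_refl)
  also have "\<dots> \<lesssim> (UNIV :: 'k set)"
    by (rule infinite_times_lepoll_self[OF assms])
  finally have "lists (UNIV :: ('k \<times> int \<times> int) set) \<lesssim> lists (UNIV :: 'k set)"
    by (intro lists_lepoll_mono) simp
  also have "\<dots> \<lesssim> (UNIV :: 'k set)"
    by (rule infinite_lists_lepoll_self[OF assms])
  finally show ?thesis by simp
qed

text \<open>Allots the coordinates of the cube: \<open>Inl\<close> gives the free ones,
  \<open>Inr\<close> those reserved for crooked partitions, indexed by pairs of codes.\<close>

lemma ex_inj_sum_lepoll:
  assumes "infinite (UNIV :: 'k set)" and "(UNIV :: 'l set) \<lesssim> (UNIV :: 'k set)"
  shows "\<exists>e :: 'k + ('l \<times> 'l) \<Rightarrow> 'k. inj e"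
proof -
  obtain p :: "'k \<times> 'k \<Rightarrow> 'k" where p: "inj p"
    using infinite_times_lepoll_self[OF assms(1)] unfolding lepoll_def by auto
  obtain g :: "'l \<Rightarrow> 'k" where g: "inj g"
    using assms(2) unfolding lepoll_def by blast
  obtain \<iota> :: "nat \<Rightarrow> 'k" where \<iota>: "inj \<iota>"
    using assms(1) unfolding infinite_le_lepoll lepoll_def by (elim exE conjE) (rule that)
  define e where "e s = (case s of Inl a \<Rightarrow> p (\<iota> 0, a) | Inr (l, l') \<Rightarrow> p (\<iota> 1, p (g l, g l')))"
    for s :: "'k + ('l \<times> 'l)"
  have "inj e"
    by (rule injI) (auto simp: e_def inj_eq[OF p] inj_eq[OF g] inj_eq[OF \<iota>] split: sum.splits)
  then show ?thesis by blast
qed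

text \<open>Lets a copy of the cube live on the type \<open>'k set\<close>: every real coordinate is
  replaced by its lower cut of rationals, and pairs of an index and a rational are coded in
  \<open>'k\<close>.\<close>

lemma ex_inj_real_functions_to_sets:
  assumes "infinite (UNIV :: 'k set)"
  shows "\<exists>\<iota> :: ('k \<Rightarrow> real) \<Rightarrow> 'k set. inj \<iota>"
proof -
  obtain p :: "'k \<times> 'k \<Rightarrow> 'k" where p: "inj p"
    using infinite_times_lepoll_self[OF assms] unfolding lepoll_def by auto
  obtain n :: "nat \<Rightarrow> 'k" where n: "inj n"
    using assms unfolding infinite_le_lepoll lepoll_def by (elim exE conjE) (rule that)
  define P where "P a q = p (a, n (to_nat q))" for a and q :: rat
  have P: "P a q = P a' q' \<longleftrightarrow> a = a' \<and> q = q'" for a q a' q'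
    by (auto simp: P_def inj_eq[OF p] inj_eq[OF n])
  define \<iota> where "\<iota> z = {P a q | a q. of_rat q < z a}" for z :: "'k \<Rightarrow> real"
  have \<iota>: "P a q \<in> \<iota> z \<longleftrightarrow> of_rat q < z a" for a q z
    by (auto simp: \<iota>_def P)
  have "inj \<iota>"
  proof (rule injI, rule ext, rule ccontr)
    fix z z' a assume eq: "\<iota> z = \<iota> z'" and ne: "z a \<noteq> z' a"
    then obtain q where "z a < of_rat q \<and> of_rat q < z' a \<or> z' a < of_rat q \<and> of_rat q < z a"
      using of_rat_dense[of "z a" "z' a"] of_rat_dense[of "z' a" "z a"] by (meson linorder_neqE)
    then show False
      using eq \<iota>[of a q z] \<iota>[of a q z'] by auto
  qed
  then show ?thesis by blast
qed

lemma ex_homeomorphic_copy: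
  fixes \<iota> :: "'a \<Rightarrow> 'b"
  assumes "inj \<iota>"
  shows "\<exists>X. homeomorphic_map X Y (inv \<iota>)"
proof -
  \<comment> \<open>\<open>inv \<iota>\<close> is meaningful only on \<open>range \<iota>\<close>,
    so the pulled back topology is confined to that set.\<close>
  define X where "X = pullback_topology (range \<iota>) (inv \<iota>) Y"
  have tX: "topspace X = \<iota> ` topspace Y"
    using assms by (auto simp: X_def topspace_pullback_topology)
  have oX: "openin X S \<longleftrightarrow> (\<exists>U. openin Y U \<and> S = \<iota> ` U)" for S
  proof -
    have "inv \<iota> -` U \<inter> range \<iota> = \<iota> ` U" for U
      using assms by auto
    then show ?thesis
      by (simp add: X_def openin_pullback_topology)
  qed
  have img: "inv \<iota> ` \<iota> ` U = U" for U
    using assms by (simp add: image_comp)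
  have "homeomorphic_map X Y (inv \<iota>)"
  proof (rule bijective_open_imp_homeomorphic_map)
    show "continuous_map X Y (inv \<iota>)"
      unfolding X_def using continuous_map_pullback[of Y Y id "range \<iota>" "inv \<iota>"] by simp
    show "open_map X Y (inv \<iota>)"
      unfolding open_map_def oX using img by auto
    show "inv \<iota> ` topspace X = topspace Y"
      by (simp add: tX img)
    show "inj_on (inv \<iota>) (topspace X)"
      using assms by (auto simp: tX inj_on_def)
  qed
  then show ?thesis by blast
qed

subsection \<open>Crooked partitions\<close>

text \<open>For \<open>n > 0\<close> the summand of \<open>(\<alpha>, n, m)\<close> vanishes where
  \<open>z \<alpha>\<close> is within \<open>1/n\<close> of \<open>m/n\<close> and is at least 1
  beyond distance \<open>2/n\<close>. A list thus codes a box in finitely many coordinates.\<close>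

definition bump :: "('k \<times> int \<times> int) list \<Rightarrow> ('k \<Rightarrow> real) \<Rightarrow> real" where
  "bump l z = (\<Sum>(\<alpha>, n, m)\<leftarrow>l. max 0 (\<bar>of_int n * z \<alpha> - of_int m\<bar> - 1))"

lemma bump_Nil [simp]: "bump [] z = 0"
  by (simp add: bump_def)

lemma bump_Cons [simp]:
  "bump ((\<alpha>, n, m) # l) z = max 0 (\<bar>of_int n * z \<alpha> - of_int m\<bar> - 1) + bump l z"
  by (simp add: bump_def)

lemma bump_append [simp]: "bump (l @ l') z = bump l z + bump l' z"
  by (simp add: bump_def)

lemma bump_nonneg: "0 \<le> bump l z"
  by (induction l) auto

lemma continuous_map_coordinate: "continuous_map tychonoff_cube euclideanreal (\<lambda>z. z \<alpha>)"
  using continuous_map_product_projection[of \<alpha> UNIV "\<lambda>_. top_of_set {0..1::real}"]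
  by (simp add: tychonoff_cube_def continuous_map_in_subtopology)

lemma continuous_map_bump: "continuous_map tychonoff_cube euclideanreal (bump l)"
proof (induction l)
  case (Cons x l)
  obtain \<alpha> n m where "x = (\<alpha>, n, m)" by (cases x)
  then show ?case
    using Cons by (auto intro!: continuous_intros continuous_map_coordinate)
qed (simp add: bump_def)

text \<open>A basic box around \<open>a\<close> inside \<open>U\<close> restricts finitely many
  coordinates; one triple is taken for each. Outside the box some summand is at least 1, and the
  others are nonnegative.\<close>

lemma bump_separates:
  assumes U: "openin tychonoff_cube U" and a: "a \<in> U"
  shows "\<exists>l. bump l a = 0 \<and> (\<forall>z \<in> topspace tychonoff_cube - U. bump l z \<ge> 1)"
proof -
  obtain W where W: "finite {\<alpha>. W \<alpha> \<noteq> {0..1::real}}" "\<And>\<alpha>. openin (top_of_set {0..1}) (W \<alpha>)"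
      "a \<in> Pi\<^sub>E UNIV W" "Pi\<^sub>E UNIV W \<subseteq> U"
    using U a unfolding tychonoff_cube_def openin_product_topology_alt by force
  have "\<exists>n m :: int. \<bar>of_int n * a \<alpha> - of_int m\<bar> \<le> 1 \<and>
      (\<forall>t\<in>{0..1} - W \<alpha>. \<bar>of_int n * t - of_int m\<bar> \<ge> 2)" for \<alpha>
  proof -
    have "a \<alpha> \<in> W \<alpha>" using W(3) by blast
    then obtain e where e: "e > 0" "\<And>t. \<lbrakk>t \<in> {0..1}; dist t (a \<alpha>) < e\<rbrakk> \<Longrightarrow> t \<in> W \<alpha>"
      using W(2)[of \<alpha>] unfolding openin_euclidean_subtopology_iff by blast
    \<comment> \<open>Scaling by \<open>n\<close> stretches the radius \<open>e\<close> to at least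
      3; rounding the centre to the integer \<open>m\<close> costs at most 1, which leaves
      2.\<close>
    define n where "n = \<lceil>3 / e\<rceil>"
    define m where "m = \<lfloor>of_int n * a \<alpha>\<rfloor>"
    have n: "of_int n \<ge> 3 / e"
      by (simp add: n_def)
    then have n0: "of_int n > (0::real)"
      using e(1) by (smt (verit) divide_pos_pos)
    have m: "\<bar>of_int n * a \<alpha> - of_int m\<bar> \<le> 1"
      unfolding m_def by linarith
    have "\<bar>of_int n * t - of_int m\<bar> \<ge> 2" if "t \<in> {0..1} - W \<alpha>" for t
    proof -
      have "\<bar>t - a \<alpha>\<bar> \<ge> e"
        using e(2)[of t] that by (force simp: dist_real_def)
      then have "of_int n * \<bar>t - a \<alpha>\<bar> \<ge> 3 / e * e"
        using n e(1) n0 by (intro mult_mono) auto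
      then have "\<bar>of_int n * t - of_int n * a \<alpha>\<bar> \<ge> 3"
        using e(1) n0 by (simp add: abs_mult right_diff_distrib[symmetric])
      with m show ?thesis by linarith
    qed
    with m show ?thesis by blast
  qed
  then obtain n m :: "'a \<Rightarrow> int" where nm: "\<And>\<alpha>. \<bar>of_int (n \<alpha>) * a \<alpha> - of_int (m \<alpha>)\<bar> \<le> 1"
      "\<And>\<alpha> t. t \<in> {0..1} - W \<alpha> \<Longrightarrow> \<bar>of_int (n \<alpha>) * t - of_int (m \<alpha>)\<bar> \<ge> 2"
    by metis
  obtain fs where fs: "set fs = {\<alpha>. W \<alpha> \<noteq> {0..1::real}}"
    using W(1) finite_list by blast
  define l where "l = map (\<lambda>\<alpha>. (\<alpha>, n \<alpha>, m \<alpha>)) fs"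
  have "max 0 (\<bar>of_int (n \<alpha>) * a \<alpha> - of_int (m \<alpha>)\<bar> - 1) = 0" for \<alpha>
    using nm(1)[of \<alpha>] by simp
  then have "bump (map (\<lambda>\<alpha>. (\<alpha>, n \<alpha>, m \<alpha>)) xs) a = 0" for xs
    by (induction xs) (simp_all only: list.map bump_Nil bump_Cons add_0)
  then have "bump l a = 0"
    by (simp add: l_def)
  moreover have "bump l z \<ge> 1" if z: "z \<in> topspace tychonoff_cube - U" for z
  proof -
    have "z \<notin> Pi\<^sub>E UNIV W"
      using z W(4) by blast
    then obtain \<alpha> where \<alpha>: "z \<alpha> \<notin> W \<alpha>"
      by (auto simp: PiE_UNIV_domain)
    have z1: "z \<alpha> \<in> {0..1}"
      using z unfolding topspace_tychonoff_cube by simp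
    then have "\<alpha> \<in> set fs"
      using \<alpha> fs by auto
    then obtain xs ys where "fs = xs @ \<alpha> # ys"
      by (meson split_list)
    then have "bump l z = bump (map (\<lambda>\<alpha>. (\<alpha>, n \<alpha>, m \<alpha>)) xs) z
        + (max 0 (\<bar>of_int (n \<alpha>) * z \<alpha> - of_int (m \<alpha>)\<bar> - 1) + bump (map (\<lambda>\<alpha>. (\<alpha>, n \<alpha>, m \<alpha>)) ys) z)"
      by (simp add: l_def)
    moreover have "\<bar>of_int (n \<alpha>) * z \<alpha> - of_int (m \<alpha>)\<bar> \<ge> 2"
      using nm(2)[of "z \<alpha>" \<alpha>] z1 \<alpha> by blast
    ultimately show ?thesis
      using bump_nonneg[of "map (\<lambda>\<alpha>. (\<alpha>, n \<alpha>, m \<alpha>)) xs" z] bump_nonneg[of "map (\<lambda>\<alpha>. (\<alpha>, n \<alpha>, m \<alpha>)) ys" z]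
      by linarith
  qed
  ultimately show ?thesis by blast
qed

text \<open>If \<open>a \<in> C - D\<close> and \<open>b \<in> D - C\<close> for closed sets \<open>C\<close> and \<open>D\<close>, then some \<open>foursome p\<close> is \<open>-1/2\<close> at \<open>a\<close>,
  \<open>1/2\<close> at \<open>b\<close>, nonpositive on \<open>C\<close> and nonnegative on \<open>D\<close>. Integer data make the index set as
  small as \<open>'k\<close>.\<close>

definition foursome :: "('k \<times> int \<times> int) list \<times> ('k \<times> int \<times> int) list \<Rightarrow> ('k \<Rightarrow> real) \<Rightarrow> real" where
  "foursome p z = (min 1 (bump (fst p) z) - min 1 (bump (snd p) z)) / 2"

lemma foursome_bounds: "\<bar>foursome p z\<bar> \<le> 1 / 2"
  using bump_nonneg[of "fst p" z] bump_nonneg[of "snd p" z] by (auto simp: foursome_def min_def)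

lemma continuous_map_foursome: "continuous_map tychonoff_cube euclideanreal (foursome p)"
  unfolding foursome_def
  by (auto intro!: continuous_intros continuous_map_bump)

text \<open>On \<open>[-1, 1]\<close> this cubic rises from \<open>-1\<close> to a positive value, falls to a negative one, and rises to
  \<open>1\<close>, and its local extrema lie strictly between \<open>-1/2\<close> and \<open>1/2\<close>.\<close>

definition zigzag :: "real \<Rightarrow> real" where
  "zigzag u = 2 * u ^ 3 - u"

lemma zigzag_uminus: "zigzag (- u) = - zigzag u"
  by (simp add: zigzag_def)

text \<open>Consequently the value \<open>-1/2\<close> is attained only before the first turn. For
  \<open>u \<ge> 0\<close> the bound is a sum-of-squares identity; for \<open>u\<close> between
  \<open>-1/2\<close> and 0 the cubic is nonnegative.\<close>

lemma zigzag_gt: 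
  assumes "u \<ge> - 1 / 2"
  shows "zigzag u > - 1 / 2"
proof (cases "u \<ge> 0")
  case True
  have "zigzag u + 1 / 2 = 2 * u * (u - 1 / 2)\<^sup>2 + 2 * (u - 3 / 8)\<^sup>2 + 7 / 32"
    by (simp add: zigzag_def power2_eq_square power3_eq_cube field_simps)
  moreover have "2 * u * (u - 1 / 2)\<^sup>2 \<ge> 0" "2 * (u - 3 / 8)\<^sup>2 \<ge> 0"
    using True by simp_all
  ultimately show ?thesis by linarith
next
  case False
  have "u * u \<le> 1 / 2 * (1 / 2)"
    using False assms mult_mono[of "- u" "1 / 2" "- u" "1 / 2"] by simp
  then have "u * (2 * (u * u) - 1) \<ge> 0"
    using False by (intro mult_nonpos_nonpos) auto
  then show ?thesis
    by (simp add: zigzag_def power3_eq_cube algebra_simps)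
qed

lemma zigzag_lt: "u \<le> 1 / 2 \<Longrightarrow> zigzag u < 1 / 2"
  using zigzag_gt[of "- u"] by (simp add: zigzag_uminus)

lemma connectedin_real_lt:
  fixes f :: "'a \<Rightarrow> real"
  assumes f: "continuous_map X euclideanreal f" and C: "connectedin X C"
    and a: "a \<in> C" "f a < t" and t: "\<And>x. x \<in> C \<Longrightarrow> f x \<noteq> t" and x: "x \<in> C"
  shows "f x < t"
proof (rule ccontr)
  assume "\<not> f x < t"
  moreover have "is_interval (f ` C)"
    using connectedin_continuous_map_image[OF f C] by (simp add: is_interval_connected_1)
  ultimately have "t \<in> f ` C"
    using a x unfolding is_interval_1 by (meson imageI less_imp_le not_le)
  with t show False by blast
qed

lemma zigzag_hereditarily_indecomposable:
  fixes X :: "'a topology" and c :: "'a \<Rightarrow> 'k \<Rightarrow> real" and j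
  assumes X: "compact_space X" "Hausdorff_space X" and c: "homeomorphic_map X tychonoff_cube c"
    and M: "closedin X M" "\<And>x p. x \<in> M \<Longrightarrow> zigzag (2 * c x (j p) - 1) = foursome p (c x)"
  shows "hereditarily_indecomposable (subtopology X M)"
  unfolding hereditarily_indecomposable_def
proof (intro conjI allI impI)
  show "compact_space (subtopology X M)"
    using X M by (simp add: compact_space_subtopology closedin_compact_space)
  show "Hausdorff_space (subtopology X M)"
    using X by (simp add: Hausdorff_space_subtopology)
  have ct: "continuous_map X tychonoff_cube c"
    using c by (rule homeomorphic_imp_continuous_map)
  have sep: "\<exists>l. bump l (c a) = 0 \<and> (\<forall>x\<in>D. bump l (c x) \<ge> 1)"
    if D: "compactin X D" and a: "a \<in> topspace X - D" for a D
  proof -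
    have DX: "D \<subseteq> topspace X" "openin X (topspace X - D)"
      using compactin_imp_closedin[OF X(2) D] compactin_subset_topspace[OF D] by auto
    then have "openin tychonoff_cube (c ` (topspace X - D))"
      using c homeomorphic_map_openness_eq by blast
    moreover have "c x \<in> topspace tychonoff_cube - c ` (topspace X - D)" if "x \<in> D" for x
      using that DX(1) c by (auto simp: homeomorphic_eq_everything_map inj_on_def)
    ultimately show ?thesis
      using bump_separates[of "c ` (topspace X - D)" "c a"] a by blast
  qed
  fix C D assume "subcontinuum (subtopology X M) C \<and> subcontinuum (subtopology X M) D \<and> C \<inter> D \<noteq> {}"
  then have C: "compactin X C" "connectedin X C" "C \<subseteq> M"
    and D: "compactin X D" "connectedin X D" "D \<subseteq> M" and CD: "C \<inter> D \<noteq> {}"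
    by (auto simp: subcontinuum_def compactin_subtopology connectedin_subtopology)
  show "C \<subseteq> D \<or> D \<subseteq> C"
  proof (rule ccontr)
    assume "\<not> ?thesis"
    then obtain a b where a: "a \<in> C" "a \<notin> D" and b: "b \<in> D" "b \<notin> C" by blast
    then have "a \<in> topspace X - D" "b \<in> topspace X - C"
      using compactin_subset_topspace C(1) D(1) by blast+
    then obtain l l' where l: "bump l (c a) = 0" "\<And>x. x \<in> D \<Longrightarrow> bump l (c x) \<ge> 1"
      and l': "bump l' (c b) = 0" "\<And>x. x \<in> C \<Longrightarrow> bump l' (c x) \<ge> 1"
      using sep[OF D(1), of a] sep[OF C(1), of b] by metis
    define g where "g x = foursome (l, l') (c x)" for x
    define u where "u x = 2 * c x (j (l, l')) - 1" for x
    have zg: "zigzag (u x) = g x" if "x \<in> M" for x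
      using M(2)[OF that] by (simp add: u_def g_def)
    have gab: "g a = - 1 / 2" "g b = 1 / 2"
      using l(1) l(2)[OF b(1)] l'(1) l'(2)[OF a(1)] by (simp_all add: g_def foursome_def)
    have gC: "g x \<le> 0" if "x \<in> C" for x
      using l'(2)[OF that] by (simp add: g_def foursome_def)
    have gD: "g x \<ge> 0" if "x \<in> D" for x
      using l(2)[OF that] by (simp add: g_def foursome_def)
    have "continuous_map X euclideanreal (\<lambda>x. c x (j (l, l')))"
      using continuous_map_compose[OF ct continuous_map_coordinate] by (simp add: o_def)
    then have uc: "continuous_map X euclideanreal u"
      unfolding u_def by (intro continuous_intros)
    \<comment> \<open>The levels \<open>u = -1/2\<close> and \<open>u = 1/2\<close> act as barriers:
      the positive value \<open>1/4\<close> is impossible on \<open>C\<close>, where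
      \<open>g \<le> 0\<close>, and the negative value \<open>-1/4\<close> is impossible on
      \<open>D\<close>, where \<open>g \<ge> 0\<close>.\<close>
    have half: "zigzag (1 / 2) = - 1 / 4" "zigzag (- 1 / 2) = 1 / 4"
      by (simp_all add: zigzag_def power3_eq_cube)
    have ltC: "u x < - 1 / 2" if "x \<in> C" for x
    proof (rule connectedin_real_lt[OF uc C(2) a(1) _ _ that])
      show "u a < - 1 / 2"
        using zigzag_gt[of "u a"] zg[of a] a C(3) gab by force
      show "u y \<noteq> - 1 / 2" if "y \<in> C" for y
        using zg[of y] gC[OF that] that C(3) half by force
    qed
    have ltD: "- u x < - 1 / 2" if "x \<in> D" for x
    proof (rule connectedin_real_lt[OF _ D(2) b(1) _ _ that])
      show "continuous_map X euclideanreal (\<lambda>x. - u x)"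
        by (intro continuous_intros uc)
      show "- u b < - 1 / 2"
        using zigzag_lt[of "u b"] zg[of b] b D(3) gab by force
      have "u y \<noteq> 1 / 2" if "y \<in> D" for y
        using zg[of y] gD[OF that] that D(3) half by force
      then show "- u y \<noteq> - 1 / 2" if "y \<in> D" for y
        using that by force
    qed
    from CD ltC ltD show False by force
  qed
qed

section \<open>Weight of subspaces of the cube that map onto the cube\<close>

text \<open>For each direction, finitely many base elements separate the compact preimage of one
  face from the opposite one. Surjectivity makes these finite families distinct, and an infinite
  base has no more finite subfamilies than elements.\<close>

lemma weight_ge_of_map_onto_cube:
  fixes f :: "'a \<Rightarrow> 'k \<Rightarrow> real"
  assumes K: "compact_space K" and f: "continuous_map K tychonoff_cube f"
    and onto: "f ` topspace K = topspace tychonoff_cube"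
    and inf: "infinite (UNIV :: 'k set)" and B: "base_of K \<B>"
  shows "(UNIV :: 'k set) \<lesssim> \<B>"
proof -
  have "\<forall>\<alpha>. \<exists>\<F>. finite \<F> \<and> \<F> \<subseteq> \<B> \<and> {x \<in> topspace K. f x \<alpha> = 0} \<subseteq> \<Union>\<F> \<and>
      \<Union>\<F> \<subseteq> {x \<in> topspace K. f x \<alpha> < 1}"
  proof
    fix \<alpha>
    have fc: "continuous_map K euclideanreal (\<lambda>x. f x \<alpha>)"
      using continuous_map_compose[OF f continuous_map_coordinate] by (simp add: o_def)
    have "closedin K {x \<in> topspace K. f x \<alpha> \<in> {0}}"
      by (rule closedin_continuous_map_preimage[OF fc]) simp
    then have cp: "compactin K {x \<in> topspace K. f x \<alpha> = 0}"
      using closedin_compact_space[OF K] by simp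
    have "openin K {x \<in> topspace K. f x \<alpha> \<in> {..<1}}"
      by (rule openin_continuous_map_preimage[OF fc]) simp
    then have "openin K {x \<in> topspace K. f x \<alpha> < 1}"
      by simp
    then obtain \<C> where \<C>: "\<C> \<subseteq> \<B>" "\<Union>\<C> = {x \<in> topspace K. f x \<alpha> < 1}"
      using B[unfolded base_of_def, THEN conjunct2, rule_format] by meson
    have "\<exists>\<F>. finite \<F> \<and> \<F> \<subseteq> \<C> \<and> {x \<in> topspace K. f x \<alpha> = 0} \<subseteq> \<Union>\<F>"
    proof (rule compactinD[OF cp])
      show "openin K S" if "S \<in> \<C>" for S
        using that \<C>(1) B unfolding base_of_def by blast
      show "{x \<in> topspace K. f x \<alpha> = 0} \<subseteq> \<Union>\<C>"
        unfolding \<C>(2) by auto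
    qed
    then obtain \<F> where \<F>: "finite \<F>" "\<F> \<subseteq> \<C>" "{x \<in> topspace K. f x \<alpha> = 0} \<subseteq> \<Union>\<F>"
      by meson
    then have "\<F> \<subseteq> \<B>" "\<Union>\<F> \<subseteq> {x \<in> topspace K. f x \<alpha> < 1}"
      using Union_mono[OF \<F>(2)] \<C> by simp_all
    with \<F> show "\<exists>\<F>. finite \<F> \<and> \<F> \<subseteq> \<B> \<and> {x \<in> topspace K. f x \<alpha> = 0} \<subseteq> \<Union>\<F> \<and>
      \<Union>\<F> \<subseteq> {x \<in> topspace K. f x \<alpha> < 1}"
      by (intro exI[of _ \<F>]) simp
  qed
  from choice[OF this] obtain F where "\<forall>\<alpha>. finite (F \<alpha>) \<and> F \<alpha> \<subseteq> \<B> \<and>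
      {x \<in> topspace K. f x \<alpha> = 0} \<subseteq> \<Union>(F \<alpha>) \<and> \<Union>(F \<alpha>) \<subseteq> {x \<in> topspace K. f x \<alpha> < 1}"
    by (elim exE) (rule that)
  then have F: "\<And>\<alpha>. finite (F \<alpha>)" "\<And>\<alpha>. F \<alpha> \<subseteq> \<B>"
      "\<And>\<alpha>. {x \<in> topspace K. f x \<alpha> = 0} \<subseteq> \<Union>(F \<alpha>)" "\<And>\<alpha>. \<Union>(F \<alpha>) \<subseteq> {x \<in> topspace K. f x \<alpha> < 1}"
    by simp_all
  have "inj F"
  proof (rule injI, rule ccontr)
    fix \<alpha> \<beta> assume eq: "F \<alpha> = F \<beta>" and ne: "\<alpha> \<noteq> \<beta>"
    \<comment> \<open>A preimage of this vertex lies in the union of \<open>F \<alpha>\<close> but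
      not in that of \<open>F \<beta>\<close>.\<close>
    have "(\<lambda>\<gamma>. if \<gamma> = \<beta> then 1 else 0) \<in> f ` topspace K"
      by (simp add: onto topspace_tychonoff_cube)
    then obtain x where "x \<in> topspace K" "f x = (\<lambda>\<gamma>. if \<gamma> = \<beta> then 1 else 0)"
      by (metis imageE)
    then have "x \<in> topspace K" "f x \<alpha> = 0" "f x \<beta> = 1"
      using ne by auto
    then show False
      using F(3)[of \<alpha>] F(4)[of \<beta>] eq by force
  qed
  moreover have "range F \<subseteq> Fpow \<B>"
    using F by (auto simp: Fpow_def)
  ultimately have le: "(UNIV :: 'k set) \<lesssim> Fpow \<B>"
    unfolding lepoll_def by blast
  have "infinite \<B>"
  proof
    assume "finite \<B>"
    then have "finite (Fpow \<B>)"
      by (simp add: Fpow_def)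
    with le inf show False
      unfolding lepoll_def by (meson inj_on_finite)
  qed
  then show ?thesis
    using lepoll_trans[OF le infinite_Fpow_lepoll_self] by blast
qed

text \<open>The sublevel sets of the coded bumps form a base, which bounds the weight from above;
  the map onto the cube bounds it from below.\<close>

lemma has_weight_of_map_onto_cube:
  fixes c :: "'a \<Rightarrow> 'k \<Rightarrow> real" and f :: "'a \<Rightarrow> 'k \<Rightarrow> real"
  assumes c: "homeomorphic_map X tychonoff_cube c" and M: "M \<subseteq> topspace X"
    and K: "compact_space (subtopology X M)"
    and f: "continuous_map (subtopology X M) tychonoff_cube f" "f ` M = topspace tychonoff_cube"
    and inf: "infinite (UNIV :: 'k set)"
  shows "has_weight (subtopology X M) (UNIV :: 'k set)"
proof -
  define S where "S l = {x \<in> M. bump l (c x) < 1}" for l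
  have ct: "continuous_map X tychonoff_cube c"
    using c by (rule homeomorphic_imp_continuous_map)
  have tK: "topspace (subtopology X M) = M"
    using M by auto
  have oS: "openin (subtopology X M) (S l)" for l
  proof -
    have "continuous_map X euclideanreal (\<lambda>x. bump l (c x))"
      using continuous_map_compose[OF ct continuous_map_bump] by (simp add: o_def)
    then have "openin X {x \<in> topspace X. bump l (c x) \<in> {..<1}}"
      by (rule openin_continuous_map_preimage) simp
    moreover have "S l = {x \<in> topspace X. bump l (c x) \<in> {..<1}} \<inter> M"
      using M by (auto simp: S_def)
    ultimately show ?thesis
      unfolding openin_subtopology by blast
  qed
  have "base_of (subtopology X M) (range S)"
    unfolding base_of_def
  proof (intro conjI allI impI)
    show "\<forall>B\<in>range S. openin (subtopology X M) B"
      using oS by blast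
    fix U assume "openin (subtopology X M) U"
    then obtain V where V: "openin X V" "U = V \<inter> M"
      by (auto simp: openin_subtopology)
    have basic: "\<exists>l. a \<in> S l \<and> S l \<subseteq> U" if a: "a \<in> U" for a
    proof -
      have "openin tychonoff_cube (c ` V)"
        using V(1) c homeomorphic_map_openness_eq by blast
      moreover have "c a \<in> c ` V"
        using a V by blast
      ultimately obtain l where l: "bump l (c a) = 0" "\<And>z. z \<in> topspace tychonoff_cube - c ` V \<Longrightarrow> bump l z \<ge> 1"
        using bump_separates by meson
      have "x \<in> V" if "x \<in> S l" for x
      proof (rule ccontr)
        assume "x \<notin> V"
        moreover have "x \<in> topspace X" "bump l (c x) < 1"
          using that M by (auto simp: S_def)
        ultimately have "c x \<in> topspace tychonoff_cube - c ` V"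
          using c openin_subset[OF V(1)] by (auto simp: homeomorphic_eq_everything_map inj_on_def)
        then show False
          using l(2) \<open>bump l (c x) < 1\<close> by force
      qed
      then show ?thesis
        using a l(1) V by (intro exI[of _ l]) (auto simp: S_def)
    qed
    have "\<Union>{B \<in> range S. B \<subseteq> U} = U"
    proof (intro equalityI subsetI)
      fix a assume "a \<in> U"
      then obtain l where "a \<in> S l" "S l \<subseteq> U"
        using basic by meson
      then show "a \<in> \<Union>{B \<in> range S. B \<subseteq> U}" by blast
    qed auto
    then show "\<exists>\<C>. \<C> \<subseteq> range S \<and> \<Union>\<C> = U"
      by (intro exI[of _ "{B \<in> range S. B \<subseteq> U}"]) simp
  qed
  moreover have ge: "(UNIV :: 'k set) \<lesssim> \<B>" if "base_of (subtopology X M) \<B>" for \<B>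
    using weight_ge_of_map_onto_cube[OF K f(1) _ inf that] f(2) tK by simp
  moreover have "range S \<lesssim> (UNIV :: 'k set)"
    by (rule lepoll_trans[OF image_lepoll infinite_int_triples_lists_lepoll[OF inf]])
  ultimately show ?thesis
    unfolding has_weight_def by (meson lepoll_antisym)
qed

section \<open>Construction of the continuum\<close>

text \<open>The given functions on the free coordinates and the crooked equations on the reserved
  ones form a single Poincare-Miranda system on the cube. Its solution lies in all crooked
  partitions and is a common zero of the given functions.\<close>

lemma zigzag_essential_on:
  fixes e :: "'k + (('k \<times> int \<times> int) list \<times> ('k \<times> int \<times> int) list) \<Rightarrow> 'k"
    and c :: "'a \<Rightarrow> 'k \<Rightarrow> real"
  assumes c: "homeomorphic_map X tychonoff_cube c" and e: "inj e"
  shows "essential_on X (\<lambda>\<alpha>. {x \<in> topspace X. c x (e (Inl \<alpha>)) = 0})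
    (\<lambda>\<alpha>. {x \<in> topspace X. c x (e (Inl \<alpha>)) = 1})
    {x \<in> topspace X. \<forall>p. zigzag (2 * c x (e (Inr p)) - 1) = foursome p (c x)}"
    (is "essential_on X ?A ?B ?N")
  unfolding essential_on_def
proof (intro conjI allI impI)
  have ct: "continuous_map X tychonoff_cube c"
    using c by (rule homeomorphic_imp_continuous_map)
  have zc: "continuous_map tychonoff_cube euclideanreal (\<lambda>z. zigzag (2 * z \<beta> - 1) - foursome p z)" for \<beta> p
    unfolding zigzag_def
    by (intro continuous_intros continuous_map_coordinate continuous_map_foursome)
  have xc: "continuous_map X euclideanreal (\<lambda>x. zigzag (2 * c x (e (Inr p)) - 1) - foursome p (c x))" for p
    using continuous_map_compose[OF ct zc[of "e (Inr p)" p]] unfolding o_def .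
  have "closedin X {x \<in> topspace X. zigzag (2 * c x (e (Inr p)) - 1) - foursome p (c x) \<in> {0}}" for p
    by (rule closedin_continuous_map_preimage[OF xc]) simp
  then have "closedin X (\<Inter>p. {x \<in> topspace X. zigzag (2 * c x (e (Inr p)) - 1) - foursome p (c x) \<in> {0}})"
    by (intro closedin_Inter) auto
  moreover have "(\<Inter>p. {x \<in> topspace X. zigzag (2 * c x (e (Inr p)) - 1) - foursome p (c x) \<in> {0}}) = ?N"
    by auto
  ultimately show "closedin X ?N"
    by simp
  obtain d where cd: "homeomorphic_maps X tychonoff_cube c d"
    using c homeomorphic_map_maps by blast
  then have d: "continuous_map tychonoff_cube X d" "\<And>z. z \<in> topspace tychonoff_cube \<Longrightarrow> c (d z) = z"
    by (auto simp: homeomorphic_maps_def)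
  have dX: "d z \<in> topspace X" if "z \<in> topspace tychonoff_cube" for z
    using d(1) that by (auto simp: continuous_map_def)
  fix \<phi> assume \<phi>: "\<forall>i. continuous_map X euclideanreal (\<phi> i) \<and> (\<forall>x\<in>?A i. \<phi> i x < 0) \<and> (\<forall>x\<in>?B i. \<phi> i x > 0)"
  \<comment> \<open>Coordinates outside the range of \<open>e\<close> carry no condition; they get a dummy equation.\<close>
  define \<Phi> where "\<Phi> \<beta> = (if \<beta> \<in> range e then case inv e \<beta> of Inl \<alpha> \<Rightarrow> (\<lambda>z. \<phi> \<alpha> (d z))
       | Inr p \<Rightarrow> (\<lambda>z. zigzag (2 * z \<beta> - 1) - foursome p z) else (\<lambda>z. z \<beta> - 1 / 2))" for \<beta>
  have \<Phi>l: "\<Phi> (e (Inl \<alpha>)) = (\<lambda>z. \<phi> \<alpha> (d z))" for \<alpha>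
    using e by (simp add: \<Phi>_def)
  have \<Phi>r: "\<Phi> (e (Inr p)) = (\<lambda>z. zigzag (2 * z (e (Inr p)) - 1) - foursome p z)" for p
    using e by (simp add: \<Phi>_def)
  have \<Phi>n: "\<Phi> \<beta> = (\<lambda>z. z \<beta> - 1 / 2)" if "\<beta> \<notin> range e" for \<beta>
    using that by (simp add: \<Phi>_def)
  have cases: "(\<exists>\<alpha>. \<beta> = e (Inl \<alpha>)) \<or> (\<exists>p. \<beta> = e (Inr p)) \<or> \<beta> \<notin> range e" for \<beta>
    by (metis obj_sumE rangeE)
  have "\<exists>z\<in>topspace tychonoff_cube. \<forall>\<beta>. \<Phi> \<beta> z = 0"
  proof (rule poincare_miranda_tychonoff)
    fix \<beta> :: 'k
    have "continuous_map tychonoff_cube euclideanreal (\<lambda>z. \<phi> \<alpha> (d z))" for \<alpha>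
      using continuous_map_compose[OF d(1)] \<phi> by (auto simp: o_def)
    moreover have "continuous_map tychonoff_cube euclideanreal (\<lambda>z. z \<beta> - 1 / 2)"
      by (intro continuous_intros continuous_map_coordinate)
    ultimately show "continuous_map tychonoff_cube euclideanreal (\<Phi> \<beta>)"
      using cases[of \<beta>] zc by (auto simp: \<Phi>l \<Phi>r \<Phi>n)
    fix z :: "'k \<Rightarrow> real" assume z: "z \<in> topspace tychonoff_cube"
    have bd: "- 1 / 2 \<le> foursome p z" "foursome p z \<le> 1 / 2" for p
      using foursome_bounds[of p z] by linarith+
    \<comment> \<open>At the ends of a reserved coordinate the zigzag is \<open>-1\<close> or
      \<open>1\<close> and dominates \<open>foursome\<close>, whose absolute value is at most
      \<open>1/2\<close>.\<close>
    have z1: "zigzag 1 = 1" "zigzag (- 1) = - 1"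
      by (simp_all add: zigzag_def)
    show "\<Phi> \<beta> z < 0" if "z \<beta> = 0"
      using cases[of \<beta>]
    proof (elim disjE exE)
      fix \<alpha> assume "\<beta> = e (Inl \<alpha>)"
      then have "d z \<in> ?A \<alpha>" using d(2)[OF z] dX[OF z] that by simp
      then have "\<phi> \<alpha> (d z) < 0" using \<phi>[THEN spec[of _ \<alpha>]] by blast
      then show ?thesis using \<open>\<beta> = e (Inl \<alpha>)\<close> by (simp add: \<Phi>l)
    next
      fix p assume "\<beta> = e (Inr p)"
      then have "\<Phi> \<beta> z = zigzag (2 * z \<beta> - 1) - foursome p z" by (simp add: \<Phi>r)
      then show ?thesis using bd(1)[of p] z1 that by simp
    qed (use \<Phi>n that in simp)
    show "\<Phi> \<beta> z > 0" if "z \<beta> = 1"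
      using cases[of \<beta>]
    proof (elim disjE exE)
      fix \<alpha> assume "\<beta> = e (Inl \<alpha>)"
      then have "d z \<in> ?B \<alpha>" using d(2)[OF z] dX[OF z] that by simp
      then have "\<phi> \<alpha> (d z) > 0" using \<phi>[THEN spec[of _ \<alpha>]] by blast
      then show ?thesis using \<open>\<beta> = e (Inl \<alpha>)\<close> by (simp add: \<Phi>l)
    next
      fix p assume "\<beta> = e (Inr p)"
      then have "\<Phi> \<beta> z = zigzag (2 * z \<beta> - 1) - foursome p z" by (simp add: \<Phi>r)
      then show ?thesis using bd(2)[of p] z1 that by simp
    qed (use \<Phi>n that in simp)
  qed
  then obtain z where z: "z \<in> topspace tychonoff_cube" "\<And>\<beta>. \<Phi> \<beta> z = 0"
    by blast
  have "zigzag (2 * z (e (Inr p)) - 1) = foursome p z" for p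
    using z(2)[of "e (Inr p)"] by (simp add: \<Phi>r)
  then have "d z \<in> ?N"
    using d(2)[OF z(1)] dX[OF z(1)] by simp
  moreover have "\<phi> \<alpha> (d z) = 0" for \<alpha>
    using z(2)[of "e (Inl \<alpha>)"] by (simp add: \<Phi>l)
  ultimately show "\<exists>x\<in>?N. \<forall>\<alpha>. \<phi> \<alpha> x = 0"
    by blast
qed

theorem theorem4p1:
  assumes "infinite (UNIV :: 'k set)"
  shows "\<exists>K :: 'k set topology. \<exists>f :: 'k set \<Rightarrow> 'k \<Rightarrow> real.
           continuum K \<and> hereditarily_indecomposable K \<and> has_weight K (UNIV :: 'k set) \<and>
           continuous_map K tychonoff_cube f \<and> f ` topspace K = topspace tychonoff_cube \<and>
           essential_map K f"
proof -
  obtain \<iota> :: "('k \<Rightarrow> real) \<Rightarrow> 'k set" where "inj \<iota>"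
    using ex_inj_real_functions_to_sets[OF assms] by (elim exE)
  obtain X where c: "homeomorphic_map X tychonoff_cube (inv \<iota>)"
    using ex_homeomorphic_copy[OF \<open>inj \<iota>\<close>, of tychonoff_cube] by (elim exE)
  define c where "c = inv \<iota>"
  note c = c[folded c_def]
  have X: "compact_space X" "Hausdorff_space X"
    using homeomorphic_map_imp_homeomorphic_space[OF c] compact_tychonoff_cube Hausdorff_tychonoff_cube
      homeomorphic_compact_space homeomorphic_Hausdorff_space by blast+
  obtain e :: "'k + (('k \<times> int \<times> int) list \<times> ('k \<times> int \<times> int) list) \<Rightarrow> 'k" where e: "inj e"
    using ex_inj_sum_lepoll[OF assms infinite_int_triples_lists_lepoll[OF assms]] by (elim exE)
  define N where "N = {x \<in> topspace X. \<forall>p. zigzag (2 * c x (e (Inr p)) - 1) = foursome p (c x)}"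
  define A where "A = (\<lambda>\<alpha>. {x \<in> topspace X. c x (e (Inl \<alpha>)) = 0})"
  define B where "B = (\<lambda>\<alpha>. {x \<in> topspace X. c x (e (Inl \<alpha>)) = 1})"
  have "essential_on X A B N"
    unfolding A_def B_def N_def by (rule zigzag_essential_on[OF c e])
  then obtain M where M: "M \<subseteq> N" "essential_on X A B M"
      "\<And>M'. \<lbrakk>M' \<subseteq> M; essential_on X A B M'\<rbrakk> \<Longrightarrow> M' = M"
    using exists_minimal_essential_on[OF X(1)] by metis
  have Mc: "closedin X M"
    using M(2) by (simp add: essential_on_def)
  then have MX: "M \<subseteq> topspace X"
    by (rule closedin_subset)
  define K where "K = subtopology X M"
  have tK: "topspace K = M"
    using MX by (auto simp: K_def)
  have con: "connectedin X M"
    using minimal_essential_on_connected[OF _ M(2,3)] X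
    by (simp add: compact_Hausdorff_or_regular_imp_normal_space)
  have Kc: "compact_space K" "connected_space K" "Hausdorff_space K"
    using X Mc con by (auto simp: K_def compact_space_subtopology closedin_compact_space
        connectedin_def Hausdorff_space_subtopology)
  have cc: "continuous_map X euclideanreal (\<lambda>x. c x \<beta>)" for \<beta>
    using continuous_map_compose[OF homeomorphic_imp_continuous_map[OF c] continuous_map_coordinate]
    by (simp add: o_def)
  \<comment> \<open>Truncating moves every target value into the open interval \<open>(0, 1)\<close> of the coordinate, so that
    essentiality yields surjectivity even over the faces of the cube.\<close>
  define f where "f x \<alpha> = max 0 (min 1 (2 * c x (e (Inl \<alpha>)) - 1 / 2))" for x \<alpha>
  have fc: "continuous_map K euclideanreal (\<lambda>x. f x \<alpha>)" for \<alpha>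
    unfolding f_def K_def
    by (intro continuous_map_from_subtopology continuous_intros continuous_map_real_max continuous_map_real_min cc)
      auto
  have f: "continuous_map K tychonoff_cube f"
    unfolding tychonoff_cube_def continuous_map_componentwise_UNIV continuous_map_in_subtopology
    using fc by (auto simp: f_def)
  have "\<exists>x\<in>M. f x = y" if y: "y \<in> topspace tychonoff_cube" for y
  proof -
    have y01: "0 \<le> y \<alpha>" "y \<alpha> \<le> 1" for \<alpha>
      using y by (auto simp: topspace_tychonoff_cube)
    have "\<exists>x\<in>M. \<forall>\<alpha>. c x (e (Inl \<alpha>)) - (y \<alpha> / 2 + 1 / 4) = 0"
    proof (rule essential_onD[OF M(2)])
      show "continuous_map X euclideanreal (\<lambda>x. c x (e (Inl \<alpha>)) - (y \<alpha> / 2 + 1 / 4))" for \<alpha>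
        by (intro continuous_intros cc)
      show "c x (e (Inl \<alpha>)) - (y \<alpha> / 2 + 1 / 4) < 0" if "x \<in> A \<alpha>" for \<alpha> x
        using that y01(1)[of \<alpha>] by (simp add: A_def)
      show "0 < c x (e (Inl \<alpha>)) - (y \<alpha> / 2 + 1 / 4)" if "x \<in> B \<alpha>" for \<alpha> x
        using that y01(2)[of \<alpha>] by (simp add: B_def)
    qed
    then obtain x where x: "x \<in> M" "\<And>\<alpha>. c x (e (Inl \<alpha>)) = y \<alpha> / 2 + 1 / 4"
      by auto
    have "f x = y"
      using y01 by (auto simp: f_def x(2) fun_eq_iff)
    with x(1) show ?thesis by blast
  qed
  then have onto: "f ` M = topspace tychonoff_cube"
    using continuous_map_image_subset_topspace[OF f] tK by blast
  then have "M \<noteq> {}"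
    by (auto simp: topspace_tychonoff_cube)
  \<comment> \<open>The preimages of faces under \<open>f\<close> are the parts of \<open>M\<close>
    where the free coordinate is at most \<open>1/4\<close> or at least \<open>3/4\<close>; they
    contain the traces of \<open>A\<close> and \<open>B\<close>.\<close>
  have "essential_family K UNIV (\<lambda>\<alpha>. {x \<in> topspace K. f x \<alpha> = 0}) (\<lambda>\<alpha>. {x \<in> topspace K. f x \<alpha> = 1})"
    unfolding K_def
  proof (rule essential_on_imp_essential_family[OF X M(2)], fold K_def)
    fix \<alpha>
    show "closedin X (A \<alpha>)" "closedin X (B \<alpha>)"
      using closedin_continuous_map_preimage[OF cc, of "{0}"] closedin_continuous_map_preimage[OF cc, of "{1}"]
      by (simp_all add: A_def B_def)
    show "closedin K {x \<in> topspace K. f x \<alpha> = 0}" "closedin K {x \<in> topspace K. f x \<alpha> = 1}"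
      using closedin_continuous_map_preimage[OF fc, of "{0}"] closedin_continuous_map_preimage[OF fc, of "{1}"]
      by simp_all
  qed (auto simp: A_def B_def disjnt_iff f_def tK)
  then have "essential_map K f"
    using f by (simp add: essential_map_def)
  moreover have "hereditarily_indecomposable K"
    unfolding K_def
    by (rule zigzag_hereditarily_indecomposable[OF X c Mc, of "\<lambda>p. e (Inr p)"]) (use M(1) N_def in blast)
  moreover have "has_weight K (UNIV :: 'k set)"
    using has_weight_of_map_onto_cube[OF c MX] Kc(1) f onto assms by (simp add: K_def)
  moreover have "continuum K"
    using Kc \<open>M \<noteq> {}\<close> by (simp add: continuum_def tK)
  ultimately show ?thesis
    using f onto tK by blast
qed

end
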